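(* Let $(X,\leqslant)$ be a partially ordered set, $(\Lambda,\leqslant)$ a totally ordered set, and $u:X\to\Lambda$ a function. Let $\Lambda_0$ be a subset of $\Lambda$ such that $u(X)\subset\Lambda_0\subset\,\downarrow(u(X))$. Consider the following statements: (1) there exists a function $u^\sharp:\Lambda_0\to X$ such that for all $(x,\lambda)\in X\times\Lambda_0$: $x\geqslant u^\sharp(\lambda)$ if and only if $u(x)\geqslant\lambda$; (2) $u$ is isotone and there exists an isotone function $u^\sharp:\Lambda_0\to X$ such that for all $(x,\lambda)\in X\times\Lambda_0$: $x\geqslant u^\sharp(u(x))$ and $u(u^\sharp(\lambda))\geqslant\lambda$; (3) for all $\lambda\in\Lambda_0$ there exists $\lambda^\sharp\in X$ such that $\{x\in X:u(x)\geqslant\lambda\}=\{x\in X:x\geqslant\lambda^\sharp\}$. Then (1), (2) and (3) are equivalent, and they imply that $u$ is quasi-Leontief. Furthermore, if $\Lambda_0=u(X)$ then they are all equivalent to $u$ being quasi-Leontief.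
   Context: A function $f$ between partially ordered sets is isotone if $x'\geqslant x$ implies $f(x')\geqslant f(x)$. For a subset $T$ of a partially ordered set $L$, $\downarrow(T)=\{y\in L:\exists t\in T,\ y\leqslant t\}$. A function $u:X\to\Lambda$ is quasi-Leontief if for every $x\in X$ there is $x^\circ\in X$ with $\{x'\in X:u(x')\geqslant u(x)\}=\{x'\in X:x'\geqslant x^\circ\}$. *)

theory Defs
  imports Main "HOL-Library.FuncSet"
begin

text \<open>
  Posets are carrier sets inside types of class \<open>order\<close> (totally ordered ones inside types of
  class \<open>linorder\<close>), with the inherited order; unlike a bare type, a carrier may be empty.
  Maps between carriers are functions in \<open>A \<rightarrow> B\<close>; their values outside \<open>A\<close> play no role.
  ``Isotone'' is the library's \<open>mono_on\<close>.
\<close>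

definition down_closure :: "'a::order set \<Rightarrow> 'a set \<Rightarrow> 'a set" where
  "down_closure L T = {y \<in> L. \<exists>t\<in>T. y \<le> t}"

definition quasi_Leontief_on :: "'a::order set \<Rightarrow> ('a \<Rightarrow> 'b::order) \<Rightarrow> bool" where
  "quasi_Leontief_on X u \<longleftrightarrow>
     (\<forall>x\<in>X. \<exists>x0\<in>X. {x'\<in>X. u x' \<ge> u x} = {x'\<in>X. x' \<ge> x0})"

definition has_galois_adjoint_on :: "'a::order set \<Rightarrow> 'b::order set \<Rightarrow> ('a \<Rightarrow> 'b) \<Rightarrow> bool" where
  "has_galois_adjoint_on X \<Lambda>0 u \<longleftrightarrow>
     (\<exists>us \<in> \<Lambda>0 \<rightarrow> X. \<forall>x\<in>X. \<forall>l\<in>\<Lambda>0. x \<ge> us l \<longleftrightarrow> u x \<ge> l)"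

definition has_unit_counit_adjoint_on :: "'a::order set \<Rightarrow> 'b::order set \<Rightarrow> ('a \<Rightarrow> 'b) \<Rightarrow> bool" where
  "has_unit_counit_adjoint_on X \<Lambda>0 u \<longleftrightarrow>
     mono_on X u \<and>
     (\<exists>us \<in> \<Lambda>0 \<rightarrow> X. mono_on \<Lambda>0 us \<and>
        (\<forall>x\<in>X. \<forall>l\<in>\<Lambda>0. x \<ge> us (u x) \<and> u (us l) \<ge> l))"

definition has_principal_upper_sections_on :: "'a::order set \<Rightarrow> 'b::order set \<Rightarrow> ('a \<Rightarrow> 'b) \<Rightarrow> bool" where
  "has_principal_upper_sections_on X \<Lambda>0 u \<longleftrightarrow>
     (\<forall>l\<in>\<Lambda>0. \<exists>ls\<in>X. {x\<in>X. u x \<ge> l} = {x\<in>X. x \<ge> ls})"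

end

theory Submission
  imports Defs
begin

lemma galois_imp_unit_counit:
  assumes X: "u ` X \<subseteq> \<Lambda>0" and g: "has_galois_adjoint_on X \<Lambda>0 u"
  shows "has_unit_counit_adjoint_on X \<Lambda>0 u"
proof -
  obtain us where us: "us \<in> \<Lambda>0 \<rightarrow> X"
    and adj: "\<And>x l. x \<in> X \<Longrightarrow> l \<in> \<Lambda>0 \<Longrightarrow> us l \<le> x \<longleftrightarrow> l \<le> u x"
    using g unfolding has_galois_adjoint_on_def by blast
  \<comment> \<open>Unit and counit come from the reflexive instances of the adjunction: level
    \<open>u x\<close> here, point \<open>us l\<close> below.\<close>
  have unit: "us (u x) \<le> x" if "x \<in> X" for x
    using that X adj by blast
  have counit: "l \<le> u (us l)" if "l \<in> \<Lambda>0" for l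
    using that us adj by blast
  have "mono_on X u"
  proof (rule mono_onI)
    fix x y assume "x \<in> X" "y \<in> X" "x \<le> y"
    \<comment> \<open>Transpose \<open>us (u x) \<le> x \<le> y\<close> across the adjunction at
      level \<open>u x\<close>.\<close>
    then show "u x \<le> u y"
      using unit[of x] adj[of y "u x"] X by (auto intro: order_trans)
  qed
  moreover have "mono_on \<Lambda>0 us"
  proof (rule mono_onI)
    fix l m assume "l \<in> \<Lambda>0" "m \<in> \<Lambda>0" "l \<le> m"
    \<comment> \<open>Dually, transpose \<open>l \<le> m \<le> u (us m)\<close> at the point
      \<open>us m\<close>.\<close>
    then show "us l \<le> us m"
      using counit[of m] adj[of "us m" l] us by (auto intro: order_trans)
  qed
  ultimately show ?thesis
    unfolding has_unit_counit_adjoint_on_def using us unit counit by blast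
qed

text \<open>Each direction applies one of the two isotone maps to the given inequality, then
  composes with the counit or the unit.\<close>

lemma unit_counit_imp_galois:
  assumes X: "u ` X \<subseteq> \<Lambda>0" and a: "has_unit_counit_adjoint_on X \<Lambda>0 u"
  shows "has_galois_adjoint_on X \<Lambda>0 u"
proof -
  obtain us where u: "mono_on X u" and us: "us \<in> \<Lambda>0 \<rightarrow> X" "mono_on \<Lambda>0 us"
    and uc: "\<And>x l. x \<in> X \<Longrightarrow> l \<in> \<Lambda>0 \<Longrightarrow> us (u x) \<le> x \<and> l \<le> u (us l)"
    using a unfolding has_unit_counit_adjoint_on_def by blast
  have "us l \<le> x \<longleftrightarrow> l \<le> u x" if x: "x \<in> X" and l: "l \<in> \<Lambda>0" for x l
  proof
    assume "us l \<le> x"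
    then have "u (us l) \<le> u x"
      using u us(1) x l by (auto intro: mono_onD)
    then show "l \<le> u x"
      using uc[OF x l] by (auto intro: order_trans)
  next
    assume "l \<le> u x"
    then have "us l \<le> us (u x)"
      using us(2) X x l by (auto intro: mono_onD)
    then show "us l \<le> x"
      using uc[OF x l] by (auto intro: order_trans)
  qed
  then show ?thesis
    unfolding has_galois_adjoint_on_def using us(1) by blast
qed

text \<open>For a fixed level both sides describe the same generator; only collecting the generators
  into one function takes an argument, namely choice over \<open>\<Lambda>0\<close>.\<close>

lemma galois_iff_principal_upper_sections:
  "has_galois_adjoint_on X \<Lambda>0 u \<longleftrightarrow> has_principal_upper_sections_on X \<Lambda>0 u"
proof
  assume "has_galois_adjoint_on X \<Lambda>0 u"
  then show "has_principal_upper_sections_on X \<Lambda>0 u"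
    unfolding has_galois_adjoint_on_def has_principal_upper_sections_on_def
    by (fastforce simp: Pi_iff)
next
  assume "has_principal_upper_sections_on X \<Lambda>0 u"
  then have "\<forall>l\<in>\<Lambda>0. \<exists>ls. ls \<in> X \<and> (\<forall>x\<in>X. ls \<le> x \<longleftrightarrow> l \<le> u x)"
    unfolding has_principal_upper_sections_on_def by blast
  then obtain us where "\<forall>l\<in>\<Lambda>0. us l \<in> X \<and> (\<forall>x\<in>X. us l \<le> x \<longleftrightarrow> l \<le> u x)"
    by (auto dest: bchoice)
  then show "has_galois_adjoint_on X \<Lambda>0 u"
    unfolding has_galois_adjoint_on_def by blast
qed

text \<open>Quantifying over points x through \<open>u x\<close> is quantifying over levels in the
  image.\<close>

lemma quasi_Leontief_iff_principal_upper_sections_image: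
  "quasi_Leontief_on X u \<longleftrightarrow> has_principal_upper_sections_on X (u ` X) u"
  unfolding quasi_Leontief_on_def has_principal_upper_sections_on_def by simp

text \<open>Used with the image of \<open>u\<close> as the smaller set of levels, to pass from (3)
  to quasi-Leontief.\<close>

lemma has_principal_upper_sections_on_subset:
  "has_principal_upper_sections_on X \<Lambda>0 u \<Longrightarrow> \<Lambda>1 \<subseteq> \<Lambda>0 \<Longrightarrow> has_principal_upper_sections_on X \<Lambda>1 u"
  unfolding has_principal_upper_sections_on_def by blast

theorem proposition2p1p8:
  fixes X :: "'a::order set"
    and \<Lambda> \<Lambda>0 :: "'b::linorder set"
    and u :: "'a \<Rightarrow> 'b"
  assumes "u \<in> X \<rightarrow> \<Lambda>"
    and "\<Lambda>0 \<subseteq> \<Lambda>"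
    and "u ` X \<subseteq> \<Lambda>0"
    and "\<Lambda>0 \<subseteq> down_closure \<Lambda> (u ` X)"
  shows "(has_galois_adjoint_on X \<Lambda>0 u \<longleftrightarrow> has_unit_counit_adjoint_on X \<Lambda>0 u) \<and>
    (has_unit_counit_adjoint_on X \<Lambda>0 u \<longleftrightarrow> has_principal_upper_sections_on X \<Lambda>0 u) \<and>
    (has_galois_adjoint_on X \<Lambda>0 u \<or> has_unit_counit_adjoint_on X \<Lambda>0 u \<or>
       has_principal_upper_sections_on X \<Lambda>0 u \<longrightarrow> quasi_Leontief_on X u) \<and>
    (\<Lambda>0 = u ` X \<longrightarrow>
       (has_galois_adjoint_on X \<Lambda>0 u \<longleftrightarrow> quasi_Leontief_on X u) \<and>
       (has_unit_counit_adjoint_on X \<Lambda>0 u \<longleftrightarrow> quasi_Leontief_on X u) \<and>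
       (has_principal_upper_sections_on X \<Lambda>0 u \<longleftrightarrow> quasi_Leontief_on X u))"
  using assms(3) galois_imp_unit_counit unit_counit_imp_galois
    galois_iff_principal_upper_sections quasi_Leontief_iff_principal_upper_sections_image
    has_principal_upper_sections_on_subset
  by metis

end
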